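(* Let $n\ge2$, and let $0\le a_1\le\cdots\le a_n$ and $0\le b_1\le\cdots\le b_n$ be real numbers such that $a_1<b_1$ and $$\sum_{k=1}^n a_k^j=\sum_{k=1}^n b_k^j$$ for all integers $j$ with $0\le j\le n-1$. Then $\rho_{n-1}(t)\ge0$ for all $t$, where $$\rho_{n-1}(t)=\sum_{k=1}^n (t-a_k)^{n-1}\mathbf 1_{[a_k,\infty)}(t)-\sum_{k=1}^n (t-b_k)^{n-1}\mathbf 1_{[b_k,\infty)}(t).$$
   Context: $\mathbf 1_S$ is the indicator function of $S$, and $0^0=1$ in the power sums. *)

theory Defs
  imports Complex_Main "HOL-Library.Indicator_Function"
begin

(* The function rho_m attached to the n-tuples a 1, ..., a n and b 1, ..., b n;
   values of a and b outside {1..n} are irrelevant. *)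
definition rho :: "nat \<Rightarrow> (nat \<Rightarrow> real) \<Rightarrow> (nat \<Rightarrow> real) \<Rightarrow> nat \<Rightarrow> real \<Rightarrow> real" where
  "rho n a b m t =
     (\<Sum>k=1..n. (t - a k) ^ m * indicator {a k..} t)
     - (\<Sum>k=1..n. (t - b k) ^ m * indicator {b k..} t)"

end

theory Submission
  imports Defs
begin

text \<open>
  The proof counts oscillations, in the manner of Rolle.  Write \<open>\<rho>\<^sub>m\<close> for \<open>rho n a b m\<close>.  For
  \<open>m \<ge> 1\<close> the derivative of \<open>\<rho>\<^sub>m\<^sub>+\<^sub>1\<close> is \<open>(m + 1) \<rho>\<^sub>m\<close>.  For \<open>1 \<le> m \<le> n - 1\<close> the function \<open>\<rho>\<^sub>m\<close>
  has bounded support: to the left of all nodes every summand is zero, and to the right of all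
  nodes \<open>\<rho>\<^sub>m(t)\<close> is the sum of \<open>(t - a\<^sub>k)\<^sup>m - (t - b\<^sub>k)\<^sup>m\<close>, which vanishes because the power
  sums agree (\<open>rho_eq_0_left\<close>, \<open>rho_eq_0_right\<close>).

  Suppose \<open>\<rho>\<^sub>n\<^sub>-\<^sub>1(t) < 0\<close>.  Then \<open>\<rho>\<^sub>n\<^sub>-\<^sub>1\<close> first decreases from 0 to a negative value and later
  increases back to 0: it makes two alternating moves, the first of them downward.  Whenever a
  differentiable function makes \<open>L\<close> alternating moves, its derivative takes values of \<open>L\<close>
  alternating signs, and if the derivative vanishes far out on both sides then it makes \<open>L + 1\<close>
  alternating moves, again starting downward (\<open>zigzag_deriv\<close>).  Going down from \<open>\<rho>\<^sub>n\<^sub>-\<^sub>1\<close> to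
  \<open>\<rho>\<^sub>1\<close> yields \<open>n\<close> alternating moves of \<open>\<rho>\<^sub>1\<close>.

  But \<open>\<rho>\<^sub>1\<close> is the sum over \<open>k\<close> of ramps \<open>(t - a\<^sub>k)\<^sub>+ - (t - b\<^sub>k)\<^sub>+\<close>, each of which is constant
  outside the interval between \<open>a\<^sub>k\<close> and \<open>b\<^sub>k\<close>, rises if \<open>a\<^sub>k < b\<^sub>k\<close> and falls if \<open>b\<^sub>k < a\<^sub>k\<close>.
  Each move of \<open>\<rho>\<^sub>1\<close> is caused by some ramp in the same direction.  Since the nodes are sorted,
  the ramp that causes a move comes strictly after the one that causes the preceding, opposite
  move (\<open>zigzag_rho_1_index\<close>).  With \<open>n\<close> moves and \<open>n\<close> ramps the first move is caused by the
  first ramp, which therefore falls; this contradicts \<open>a\<^sub>1 < b\<^sub>1\<close>.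
\<close>

section \<open>Alternating moves of a function and of its derivative\<close>

definition zigzag :: "(real \<Rightarrow> real) \<Rightarrow> nat \<Rightarrow> (nat \<Rightarrow> real) \<Rightarrow> bool" where
  "zigzag F L z \<longleftrightarrow>
     (\<forall>i<L. z i < z (Suc i) \<and> (- 1) ^ i * (F (z (Suc i)) - F (z i)) < 0)"

text \<open>
  The mean value theorem turns each move of \<open>F\<close> into a point between its ends where \<open>G\<close> has the
  sign of that move.  The \<open>L - 1\<close> steps between these \<open>L\<close> points are alternating moves of \<open>G\<close>,
  and a zero of \<open>G\<close> on either side adds one move at each end.
\<close>

lemma zigzag_deriv:
  fixes F G :: "real \<Rightarrow> real"
  assumes deriv: "\<And>x. (F has_real_derivative c * G x) (at x)" and "c > 0"
    and left: "\<And>x. \<exists>y<x. G y = 0" and right: "\<And>x. \<exists>y>x. G y = 0"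
    and zz: "zigzag F L z" and "L > 0"
  shows "\<exists>w. zigzag G (Suc L) w"
proof -
  have "\<exists>y. z i < y \<and> y < z (Suc i) \<and> (- 1) ^ i * G y < 0" if "i < L" for i
  proof -
    from zz that have lt: "z i < z (Suc i)"
      and move: "(- 1) ^ i * (F (z (Suc i)) - F (z i)) < 0"
      by (auto simp: zigzag_def)
    from MVT2[OF lt, of F "\<lambda>x. c * G x"] deriv obtain y where
      y: "z i < y" "y < z (Suc i)" "F (z (Suc i)) - F (z i) = (z (Suc i) - z i) * (c * G y)"
      by blast
    have "(- 1) ^ i * (F (z (Suc i)) - F (z i)) = ((z (Suc i) - z i) * c) * ((- 1) ^ i * G y)"
      using y(3) by simp
    with move have "((z (Suc i) - z i) * c) * ((- 1) ^ i * G y) < 0" by simp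
    moreover have "(z (Suc i) - z i) * c > 0" using lt \<open>c > 0\<close> by simp
    ultimately have "(- 1) ^ i * G y < 0"
      by (metis mult_less_0_iff order_less_asym)
    with y show ?thesis by blast
  qed
  then obtain y where
    y: "\<And>i. i < L \<Longrightarrow> z i < y i \<and> y i < z (Suc i) \<and> (- 1) ^ i * G (y i) < 0"
    by metis
  obtain lo where lo: "lo < y 0" "G lo = 0" using left by blast
  obtain hi where hi: "y (L - 1) < hi" "G hi = 0" using right by blast
  define w where "w i = (case i of 0 \<Rightarrow> lo | Suc j \<Rightarrow> if j < L then y j else hi)" for i
  have "w i < w (Suc i) \<and> (- 1) ^ i * (G (w (Suc i)) - G (w i)) < 0" if "i < Suc L" for i
  proof (cases i)
    case 0
    then show ?thesis using y[of 0] lo \<open>L > 0\<close> by (simp add: w_def)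
  next
    case (Suc j)
    with that have "j < L" by simp
    show ?thesis
    proof (cases "Suc j < L")
      case True
      then show ?thesis
        using y[of j] y[of "Suc j"] \<open>j < L\<close> Suc by (simp add: w_def algebra_simps)
    next
      case False
      with \<open>j < L\<close> have "y j < hi" using hi(1) by (metis Suc_lessI diff_Suc_1)
      then show ?thesis using y[of j] hi(2) False \<open>j < L\<close> Suc by (simp add: w_def)
    qed
  qed
  then have "zigzag G (Suc L) w" by (simp add: zigzag_def)
  then show ?thesis by blast
qed

section \<open>Truncated powers\<close>

lemma rho_eq_sum_max:
  assumes "m \<ge> 1"
  shows "rho n a b m t = (\<Sum>k=1..n. max 0 (t - a k) ^ m - max 0 (t - b k) ^ m)"
proof -
  have "(t - c) ^ m * indicator {c..} t = max 0 (t - c) ^ m" for c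
    using assms by (auto simp: indicator_def max_def)
  then show ?thesis by (simp add: rho_def sum_subtractf)
qed

text \<open>
  Only the node \<open>x = c\<close> needs care.  There the difference quotient is itself a truncated power
  with positive exponent, hence continuous with value 0, which is Caratheodory's criterion.
\<close>

lemma DERIV_truncated_power:
  fixes c x :: real
  shows "((\<lambda>t. max 0 (t - c) ^ Suc (Suc r)) has_real_derivative
          real (Suc (Suc r)) * max 0 (x - c) ^ Suc r) (at x)"
proof (cases x c rule: linorder_cases)
  case less
  have "((\<lambda>t. 0) has_real_derivative 0) (at x)" by simp
  moreover have "\<forall>\<^sub>F t in nhds x. 0 = max 0 (t - c) ^ Suc (Suc r)"
    using eventually_nhds_in_open[of "{..<c}" x] less by (auto elim!: eventually_mono)
  ultimately have "((\<lambda>t. max 0 (t - c) ^ Suc (Suc r)) has_real_derivative 0) (at x)"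
    using DERIV_cong_ev[OF refl, of "\<lambda>t. 0" "\<lambda>t. max 0 (t - c) ^ Suc (Suc r)" x 0 0] by simp
  then show ?thesis using less by simp
next
  case equal
  have "isCont (\<lambda>z. max 0 (z - c) ^ Suc r) c" by (intro continuous_intros)
  moreover have "max 0 (z - c) ^ Suc (Suc r) - max 0 (c - c) ^ Suc (Suc r)
      = max 0 (z - c) ^ Suc r * (z - c)" for z
    by (simp add: max_def)
  ultimately show ?thesis
    unfolding equal by (subst CARAT_DERIV) (intro exI[of _ "\<lambda>z. max 0 (z - c) ^ Suc r"], simp)
next
  case greater
  have "((\<lambda>t. (t - c) ^ Suc (Suc r)) has_real_derivative
          real (Suc (Suc r)) * (x - c) ^ Suc r) (at x)"
    using DERIV_power[OF DERIV_diff[OF DERIV_ident DERIV_const[of c]], of "Suc (Suc r)" x UNIV]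
    by simp
  moreover have "\<forall>\<^sub>F t in nhds x. (t - c) ^ Suc (Suc r) = max 0 (t - c) ^ Suc (Suc r)"
    using eventually_nhds_in_open[of "{c<..}" x] greater
    by (auto elim!: eventually_mono simp: max_def)
  ultimately show ?thesis
    using greater DERIV_cong_ev[OF refl, of "\<lambda>t. (t - c) ^ Suc (Suc r)"] by (simp add: max_def)
qed

lemma DERIV_rho:
  "(rho n a b (Suc (Suc r)) has_real_derivative real (Suc (Suc r)) * rho n a b (Suc r) x) (at x)"
proof -
  have eq: "rho n a b (Suc (Suc r)) =
      (\<lambda>t. \<Sum>k=1..n. max 0 (t - a k) ^ Suc (Suc r) - max 0 (t - b k) ^ Suc (Suc r))"
    by (rule ext, rule rho_eq_sum_max) simp
  have "real (Suc (Suc r)) * rho n a b (Suc r) x = (\<Sum>k=1..n.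
      real (Suc (Suc r)) * max 0 (x - a k) ^ Suc r - real (Suc (Suc r)) * max 0 (x - b k) ^ Suc r)"
    by (subst rho_eq_sum_max) (simp_all only: sum_distrib_left right_diff_distrib le_simps)
  then show ?thesis
    unfolding eq by (simp only:) (intro DERIV_sum DERIV_diff DERIV_truncated_power)
qed

section \<open>Bounded support\<close>

text \<open>Expanding \<open>(t - a\<^sub>k)\<^sup>m\<close> by the binomial theorem involves only power sums up to degree \<open>m\<close>.\<close>

lemma power_sums_shift:
  fixes a b :: "nat \<Rightarrow> real"
  assumes "\<And>j. j \<le> m \<Longrightarrow> (\<Sum>k\<in>A. a k ^ j) = (\<Sum>k\<in>A. b k ^ j)"
  shows "(\<Sum>k\<in>A. (t - a k) ^ m) = (\<Sum>k\<in>A. (t - b k) ^ m)"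
proof -
  have expand: "(\<Sum>k\<in>A. (t - c k) ^ m)
      = (\<Sum>j\<le>m. real (m choose j) * (- 1) ^ j * t ^ (m - j) * (\<Sum>k\<in>A. c k ^ j))"
    for c :: "nat \<Rightarrow> real"
  proof -
    have "(t - x) ^ m = (\<Sum>j\<le>m. real (m choose j) * (- 1) ^ j * t ^ (m - j) * x ^ j)" for x
      using binomial_ring[of "- x" t m]
      by (simp add: power_minus[of x] mult_ac)
    then show ?thesis
      by (simp add: sum_distrib_left sum.swap[of _ _ A])
  qed
  show ?thesis unfolding expand using assms by simp
qed

lemma rho_eq_0_left:
  assumes "m \<ge> 1"
  shows "\<exists>y<x. rho n a b m y = 0"
proof -
  define y where "y = Min (insert x (a ` {1..n} \<union> b ` {1..n})) - 1"
  have *: "y \<le> u - 1" if "u \<in> insert x (a ` {1..n} \<union> b ` {1..n})" for u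
    unfolding y_def using that by (intro diff_right_mono Min_le) auto
  have "max 0 (y - a k) = 0" "max 0 (y - b k) = 0" if "k \<in> {1..n}" for k
    using *[of "a k"] *[of "b k"] that by auto
  then have "rho n a b m y = 0"
    using assms by (simp add: rho_eq_sum_max)
  moreover have "y < x" using *[of x] by simp
  ultimately show ?thesis by blast
qed

lemma rho_eq_0_right:
  assumes "m \<ge> 1" and "\<And>j. j \<le> m \<Longrightarrow> (\<Sum>k=1..n. a k ^ j) = (\<Sum>k=1..n. b k ^ j)"
  shows "\<exists>y>x. rho n a b m y = 0"
proof -
  define y where "y = Max (insert x (a ` {1..n} \<union> b ` {1..n})) + 1"
  have *: "u + 1 \<le> y" if "u \<in> insert x (a ` {1..n} \<union> b ` {1..n})" for u
    unfolding y_def using that by (intro add_right_mono Max_ge) auto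
  have "max 0 (y - a k) = y - a k" "max 0 (y - b k) = y - b k" if "k \<in> {1..n}" for k
    using *[of "a k"] *[of "b k"] that by auto
  then have "rho n a b m y = (\<Sum>k=1..n. (y - a k) ^ m) - (\<Sum>k=1..n. (y - b k) ^ m)"
    using assms(1) by (simp add: rho_eq_sum_max sum_subtractf)
  also have "\<dots> = 0"
    using power_sums_shift[of m a "{1..n}" b y] assms(2) by simp
  finally have "rho n a b m y = 0" .
  moreover have "y > x" using *[of x] by simp
  ultimately show ?thesis by blast
qed

section \<open>Counting the moves of the piecewise linear function\<close>

text \<open>
  Consecutive moves are caused by ramps in opposite directions.  Say a falling ramp \<open>k\<close> acts
  before the point \<open>p\<close> and a rising ramp \<open>k'\<close> after it.  Then \<open>b\<^sub>k < p\<close>, because the fall starts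
  at \<open>b\<^sub>k\<close>, and \<open>p < b\<^sub>k\<^sub>'\<close>, because the rise ends at \<open>b\<^sub>k\<^sub>'\<close>; as \<open>b\<close> is sorted, \<open>k < k'\<close>.  In the
  other case \<open>a\<close> takes the role of \<open>b\<close>.
\<close>

lemma zigzag_rho_1_index:
  assumes "mono_on {1..n} a" "mono_on {1..n} b" and zz: "zigzag (rho n a b 1) L z"
  obtains K where "\<And>i. i < L \<Longrightarrow> K i \<in> {1..n}"
    and "\<And>i. Suc i < L \<Longrightarrow> K i < K (Suc i)"
    and "0 < L \<Longrightarrow> b (K 0) < a (K 0)"
proof -
  define h where "h k t = max 0 (t - a k) - max 0 (t - b k)" for k t
  have "\<exists>k\<in>{1..n}. (- 1) ^ i * (h k (z (Suc i)) - h k (z i)) < 0" if "i < L" for i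
  proof (rule ccontr)
    assume "\<not> ?thesis"
    then have "0 \<le> (\<Sum>k=1..n. (- 1) ^ i * (h k (z (Suc i)) - h k (z i)))"
      by (intro sum_nonneg) (auto simp: not_less)
    also have "\<dots> = (- 1) ^ i * (rho n a b 1 (z (Suc i)) - rho n a b 1 (z i))"
      by (simp add: rho_eq_sum_max h_def flip: sum_distrib_left sum_subtractf)
    finally show False using zz that by (auto simp: zigzag_def)
  qed
  then obtain K where K: "\<And>i. i < L \<Longrightarrow> K i \<in> {1..n}"
    and move: "\<And>i. i < L \<Longrightarrow> (- 1) ^ i * (h (K i) (z (Suc i)) - h (K i) (z i)) < 0"
    by metis
  have fall: "b (K i) < z (Suc i) \<and> z i < a (K i) \<and> b (K i) < a (K i)" if "i < L" "even i" for i
    using move[OF that(1)] that zz unfolding h_def zigzag_def max_def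
    by (auto split: if_splits)
  have rise: "a (K i) < z (Suc i) \<and> z i < b (K i) \<and> a (K i) < b (K i)" if "i < L" "odd i" for i
    using move[OF that(1)] that zz unfolding h_def zigzag_def max_def
    by (auto split: if_splits)
  have less: "K i < K (Suc i)" if i: "Suc i < L" for i
  proof (rule ccontr)
    assume "\<not> K i < K (Suc i)"
    then have "a (K (Suc i)) \<le> a (K i)" "b (K (Suc i)) \<le> b (K i)"
      using assms(1,2) K[of i] K[of "Suc i"] i by (auto intro: mono_onD)
    then show False
      using fall[of i] rise[of i] fall[of "Suc i"] rise[of "Suc i"] i
      by (cases "even i") auto
  qed
  show thesis
    by (rule that[of K]) (use K less fall[of 0] in auto)
qed

section \<open>Nonnegativity\<close>

theorem proposition4p3:
  fixes n :: nat and a b :: "nat \<Rightarrow> real" and t :: real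
  assumes "n \<ge> 2"
    and "0 \<le> a 1" and "mono_on {1..n} a"
    and "0 \<le> b 1" and "mono_on {1..n} b"
    and "a 1 < b 1"
    and "\<And>j. j \<le> n - 1 \<Longrightarrow> (\<Sum>k=1..n. a k ^ j) = (\<Sum>k=1..n. b k ^ j)"
  shows "rho n a b (n - 1) t \<ge> 0"
proof (rule ccontr)
  assume "\<not> rho n a b (n - 1) t \<ge> 0"
  then have neg: "rho n a b (n - 1) t < 0" by simp
  have left: "\<exists>y<x. rho n a b m y = 0" if "m \<ge> 1" for m x
    using that by (rule rho_eq_0_left)
  have right: "\<exists>y>x. rho n a b m y = 0" if "m \<ge> 1" "m \<le> n - 1" for m x
    using that assms(7) by (intro rho_eq_0_right) auto
  have descent: "\<exists>z. zigzag (rho n a b (n - 1 - j)) (j + 2) z" if "j \<le> n - 2" for j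
    using that
  proof (induction j)
    case 0
    obtain lo where lo: "lo < t" "rho n a b (n - 1) lo = 0"
      using left[of "n - 1" t] assms(1) by force
    obtain hi where hi: "hi > t" "rho n a b (n - 1) hi = 0"
      using right[of "n - 1" t] assms(1) by force
    have "zigzag (rho n a b (n - 1)) 2 (\<lambda>i. if i = 0 then lo else if i = 1 then t else hi)"
      using lo hi neg by (auto simp: zigzag_def less_2_cases_iff)
    then show ?case unfolding add_0 diff_zero by blast
  next
    case (Suc j)
    then obtain z where z: "zigzag (rho n a b (n - 1 - j)) (j + 2) z" by auto
    obtain r where r: "n - 1 - j = Suc (Suc r)"
      using Suc.prems that[of "n - 3 - j"] by auto
    then have r': "n - 1 - Suc j = Suc r" by simp
    have "\<exists>w. zigzag (rho n a b (Suc r)) (Suc (j + 2)) w"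
    proof (rule zigzag_deriv)
      show "(rho n a b (Suc (Suc r)) has_real_derivative
          real (Suc (Suc r)) * rho n a b (Suc r) x) (at x)" for x
        by (rule DERIV_rho)
      show "zigzag (rho n a b (Suc (Suc r))) (j + 2) z" using z r by simp
      show "\<exists>y<x. rho n a b (Suc r) y = 0" for x by (rule left) simp
      show "\<exists>y>x. rho n a b (Suc r) y = 0" for x using r by (intro right) auto
    qed simp_all
    then show ?case using r' by simp
  qed
  have idx: "n - 1 - (n - 2) = 1" "n - 2 + 2 = n" using assms(1) by auto
  from descent[of "n - 2", unfolded idx] obtain z where "zigzag (rho n a b 1) n z" by blast
  then obtain K where K: "\<And>i. i < n \<Longrightarrow> K i \<in> {1..n}"
    and less: "\<And>i. Suc i < n \<Longrightarrow> K i < K (Suc i)" and K0: "0 < n \<Longrightarrow> b (K 0) < a (K 0)"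
    using zigzag_rho_1_index assms(3,5) by blast
  have "K 0 + i \<le> K i" if "i < n" for i
    using that
  proof (induction i)
    case (Suc i)
    then show ?case using less[of i] by simp
  qed simp
  from this[of "n - 1"] K[of "n - 1"] K[of 0] have "K 0 = 1" using assms(1) by auto
  with K0 assms(1,6) show False by simp
qed

end
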